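(* Let $\alpha,\beta\in(0,1]$, $A,B\in\mathbb{R}$, and let $L=L(t,u,v,w):\mathbb{T}^\kappa\times\mathbb{R}\times\mathbb{R}\times\mathbb{R}\to\mathbb{R}$ be a function whose second-order partial derivatives $L_{uu},L_{uv},L_{uw},L_{vw},L_{vv},L_{ww}$ exist and are continuous. Let (P) be the problem of minimizing $$\mathcal{L}(y)=\sum_{t=a}^{b-1}L\bigl(t,y^{\sigma}(t),{}_a\Delta_t^\alpha y(t),{}_t\Delta_b^\beta y(t)\bigr)$$ over $y\in\mathcal{F}$ subject to $y(a)=A$ and $y(b)=B$. If $\tilde y\in\mathcal{F}$ is a local minimizer for problem (P), then $$L_u[\tilde y](t)+{}_t\Delta_{\rho(b)}^\alpha L_v[\tilde y](t)+{}_a\Delta_t^\beta L_w[\tilde y](t)=0$$ for all $t\in\mathbb{T}^{\kappa^2}$, where $[y](s)=\bigl(s,y^{\sigma}(s),{}_a\Delta_s^\alpha y(s),{}_s\Delta_b^\beta y(s)\bigr)$. Here ${}_t\Delta_{\rho(b)}^\alpha L_v[\tilde y](t)$ and ${}_a\Delta_t^\beta L_w[\tilde y](t)$ denote the fractional differences of the functions $s\mapsto L_v([\tilde y](s))$ and $s\mapsto L_w([\tilde y](s))$ on $\mathbb{T}^\kappa$, evaluated at $t$.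
   Context: Let $a\in\mathbb{R}$ and $b=a+k$ with $k\in\mathbb{N}$, $k\ge 2$. Put $\mathbb{T}=\{a,a+1,\ldots,b\}$, $\mathbb{T}^\kappa=\{a,\ldots,b-1\}$, $\mathbb{T}^{\kappa^2}=\{a,\ldots,b-2\}$; $\mathcal{F}$ is the set of real-valued functions on $\mathbb{T}$. Write $\sigma(t)=t+1$, $\rho(t)=t-1$, $f^\sigma(t)=f(t+1)$, $\Delta f(t)=f(t+1)-f(t)$, and $x^{(y)}=\Gamma(x+1)/\Gamma(x+1-y)$. Empty sums are $0$. All sums run over integer steps. Fractional sums of order $\nu\ge 0$: for a function $f$ on $\{a,\ldots,c\}$ with $c\in\{b-1,b\}$ and $t\in\{a,\ldots,c\}$, $${}_a\Delta_t^{-\nu}f(t)=f(t)+\frac{\nu}{\Gamma(\nu+1)}\sum_{s=a}^{t-1}(t+\nu-\sigma(s))^{(\nu-1)}f(s),$$ $${}_t\Delta_c^{-\nu}f(t)=f(t)+\frac{\nu}{\Gamma(\nu+1)}\sum_{s=t+1}^{c}(s+\nu-\sigma(t))^{(\nu-1)}f(s)$$ (so for $\nu=0$ both equal $f(t)$). Fractional differences of order $\alpha\in(0,1]$, with $\mu=1-\alpha$: for $t\in\{a,\ldots,c-1\}$, ${}_a\Delta_t^\alpha f(t)=\Delta({}_a\Delta_t^{-\mu}f(t))$ and ${}_t\Delta_c^\alpha f(t)=-\Delta({}_t\Delta_c^{-\mu}f(t))$, where the outer forward difference $\Delta$ acts in the variable $t$. Norm on $\mathcal{F}$: $\|f\|=\max_{t\in\mathbb{T}^\kappa}|f^\sigma(t)|+\max_{t\in\mathbb{T}^\kappa}|{}_a\Delta_t^\alpha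 f(t)|+\max_{t\in\mathbb{T}^\kappa}|{}_t\Delta_b^\beta f(t)|$. A function $\tilde y\in\mathcal{F}$ with $\tilde y(a)=A$, $\tilde y(b)=B$ is a local minimizer for (P) if there is $\delta>0$ such that $\mathcal{L}(\tilde y)\le\mathcal{L}(y)$ for all $y\in\mathcal{F}$ with $y(a)=A$, $y(b)=B$ and $\|y-\tilde y\|<\delta$. $L_u,L_v,L_w$, etc. denote partial derivatives of $L$ with respect to its second, third and fourth arguments. *)

theory Defs
  imports "HOL-Analysis.Analysis"
begin

text \<open>
  The set \<open>{p, p + 1, \<dots>, q}\<close>, which is empty for \<open>q < p\<close>. A function on \<open>{a, \<dots>, b}\<close> is
  represented by a total function on the reals; every notion below uses only its values
  on \<open>{a, \<dots>, b}\<close>, so quantifying over total functions amounts to quantifying over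
  functions on \<open>{a, \<dots>, b}\<close>.
\<close>

definition steps :: "real \<Rightarrow> real \<Rightarrow> real set" where
  "steps p q = {t. \<exists>i::nat. t = p + real i \<and> t \<le> q}"

lemma steps_eq_image: "steps p (p + real n) = (\<lambda>i. p + real i) ` {..n}"
  by (auto simp: steps_def)

lemma steps_empty: "q < p \<Longrightarrow> steps p q = {}"
  by (auto simp: steps_def)

definition fwd_diff :: "(real \<Rightarrow> real) \<Rightarrow> real \<Rightarrow> real" where
  "fwd_diff f t = f (t + 1) - f t"

definition factorial_pow :: "real \<Rightarrow> real \<Rightarrow> real" where
  "factorial_pow x y = Gamma (x + 1) / Gamma (x + 1 - y)"

definition left_frac_sum :: "real \<Rightarrow> real \<Rightarrow> (real \<Rightarrow> real) \<Rightarrow> real \<Rightarrow> real" where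
  "left_frac_sum a \<nu> f t =
     f t + \<nu> / Gamma (\<nu> + 1) *
       (\<Sum>s\<in>steps a (t - 1). factorial_pow (t + \<nu> - (s + 1)) (\<nu> - 1) * f s)"

definition right_frac_sum :: "real \<Rightarrow> real \<Rightarrow> (real \<Rightarrow> real) \<Rightarrow> real \<Rightarrow> real" where
  "right_frac_sum c \<nu> f t =
     f t + \<nu> / Gamma (\<nu> + 1) *
       (\<Sum>s\<in>steps (t + 1) c. factorial_pow (s + \<nu> - (t + 1)) (\<nu> - 1) * f s)"

definition left_frac_diff :: "real \<Rightarrow> real \<Rightarrow> (real \<Rightarrow> real) \<Rightarrow> real \<Rightarrow> real" where
  "left_frac_diff a \<alpha> f t = fwd_diff (left_frac_sum a (1 - \<alpha>) f) t"

definition right_frac_diff :: "real \<Rightarrow> real \<Rightarrow> (real \<Rightarrow> real) \<Rightarrow> real \<Rightarrow> real" where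
  "right_frac_diff c \<alpha> f t = - fwd_diff (right_frac_sum c (1 - \<alpha>) f) t"

text \<open>A Lagrangian \<open>L\<close> takes the arguments \<open>t u v w\<close>; only \<open>t \<in> {a, \<dots>, b - 1}\<close> matters.\<close>

type_synonym lagrangian = "real \<Rightarrow> real \<Rightarrow> real \<Rightarrow> real \<Rightarrow> real"

text \<open>The composition \<open>s \<mapsto> G[y](s)\<close>.\<close>

definition along ::
  "lagrangian \<Rightarrow> real \<Rightarrow> real \<Rightarrow> real \<Rightarrow> real \<Rightarrow> (real \<Rightarrow> real) \<Rightarrow> real \<Rightarrow> real" where
  "along G a b \<alpha> \<beta> y s = G s (y (s + 1)) (left_frac_diff a \<alpha> y s) (right_frac_diff b \<beta> y s)"

definition action ::
  "lagrangian \<Rightarrow> real \<Rightarrow> real \<Rightarrow> real \<Rightarrow> real \<Rightarrow> (real \<Rightarrow> real) \<Rightarrow> real" where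
  "action L a b \<alpha> \<beta> y = (\<Sum>t\<in>steps a (b - 1). along L a b \<alpha> \<beta> y t)"

definition frac_norm :: "real \<Rightarrow> real \<Rightarrow> real \<Rightarrow> real \<Rightarrow> (real \<Rightarrow> real) \<Rightarrow> real" where
  "frac_norm a b \<alpha> \<beta> f =
     Max ((\<lambda>t. \<bar>f (t + 1)\<bar>) ` steps a (b - 1)) +
     Max ((\<lambda>t. \<bar>left_frac_diff a \<alpha> f t\<bar>) ` steps a (b - 1)) +
     Max ((\<lambda>t. \<bar>right_frac_diff b \<beta> f t\<bar>) ` steps a (b - 1))"

definition local_minimizer ::
  "lagrangian \<Rightarrow> real \<Rightarrow> real \<Rightarrow> real \<Rightarrow> real \<Rightarrow> real \<Rightarrow> real \<Rightarrow> (real \<Rightarrow> real) \<Rightarrow> bool" where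
  "local_minimizer L a b \<alpha> \<beta> A B z \<longleftrightarrow>
     z a = A \<and> z b = B \<and>
     (\<exists>\<delta>>0. \<forall>y. y a = A \<and> y b = B \<and> frac_norm a b \<alpha> \<beta> (\<lambda>t. y t - z t) < \<delta> \<longrightarrow>
        action L a b \<alpha> \<beta> z \<le> action L a b \<alpha> \<beta> y)"

definition D_u :: "lagrangian \<Rightarrow> lagrangian" where
  "D_u L t u v w = deriv (\<lambda>x. L t x v w) u"

definition D_v :: "lagrangian \<Rightarrow> lagrangian" where
  "D_v L t u v w = deriv (\<lambda>x. L t u x w) v"

definition D_w :: "lagrangian \<Rightarrow> lagrangian" where
  "D_w L t u v w = deriv (\<lambda>x. L t u v x) w"

text \<open>
  Since \<open>deriv\<close> is total, existence of the partial derivatives is stated separately.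
\<close>

definition ex_D_u :: "real set \<Rightarrow> lagrangian \<Rightarrow> bool" where
  "ex_D_u S L \<longleftrightarrow> (\<forall>t\<in>S. \<forall>u v w. (\<lambda>x. L t x v w) differentiable (at u))"

definition ex_D_v :: "real set \<Rightarrow> lagrangian \<Rightarrow> bool" where
  "ex_D_v S L \<longleftrightarrow> (\<forall>t\<in>S. \<forall>u v w. (\<lambda>x. L t u x w) differentiable (at v))"

definition ex_D_w :: "real set \<Rightarrow> lagrangian \<Rightarrow> bool" where
  "ex_D_w S L \<longleftrightarrow> (\<forall>t\<in>S. \<forall>u v w. (\<lambda>x. L t u v x) differentiable (at w))"

definition continuous_lagrangian :: "real set \<Rightarrow> lagrangian \<Rightarrow> bool" where
  "continuous_lagrangian S G \<longleftrightarrow> continuous_on (S \<times> UNIV) (\<lambda>(t, u, v, w). G t u v w)"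

text \<open>
  Existence and continuity of \<open>L_uu, L_uv, L_uw, L_vv, L_vw, L_ww\<close> (hence also existence of
  \<open>L_u, L_v, L_w\<close>), with the convention \<open>L_uv = (L_u)_v\<close>. The mixed derivatives in the
  opposite order are not assumed.
\<close>

definition continuous_second_partials :: "real set \<Rightarrow> lagrangian \<Rightarrow> bool" where
  "continuous_second_partials S L \<longleftrightarrow>
     ex_D_u S L \<and> ex_D_v S L \<and> ex_D_w S L \<and>
     ex_D_u S (D_u L) \<and> continuous_lagrangian S (D_u (D_u L)) \<and>
     ex_D_v S (D_u L) \<and> continuous_lagrangian S (D_v (D_u L)) \<and>
     ex_D_w S (D_u L) \<and> continuous_lagrangian S (D_w (D_u L)) \<and>
     ex_D_v S (D_v L) \<and> continuous_lagrangian S (D_v (D_v L)) \<and>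
     ex_D_w S (D_v L) \<and> continuous_lagrangian S (D_w (D_v L)) \<and>
     ex_D_w S (D_w L) \<and> continuous_lagrangian S (D_w (D_w L))"

end

theory Submission
  imports Defs
begin

text \<open>
  The constraints allow the variation of \<open>z\<close> by a multiple of the indicator of the single
  interior point \<open>t + 1\<close>, and the first variation of the action in this direction vanishes.
  On integer steps, left and right fractional sums have transposed triangular Toeplitz matrices
  with the same weights, so the first variation is the Euler--Lagrange expression at \<open>t\<close>.
\<close>

section \<open>Differentiation along lines\<close>

text \<open>Split the increment: at fixed \<open>y\<close> the change in \<open>x\<close> is
  governed by \<open>f'\<close>, and the change in \<open>y\<close> by the mean value theorem with
  continuity of \<open>g\<close> at the point. Only the second partial derivative has to be
  continuous, which allows adding one variable at a time.\<close>

lemma has_derivative_real_partial: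
  fixes f g :: "'a::real_normed_vector \<Rightarrow> real \<Rightarrow> real"
  assumes "((\<lambda>x. f x y) has_derivative f') (at x)"
    and "\<And>x y. (f x has_real_derivative g x y) (at y)"
    and "isCont (\<lambda>(x, y). g x y) (x, y)"
  shows "((\<lambda>(x, y). f x y) has_derivative (\<lambda>(tx, ty). f' tx + g x y * ty)) (at (x, y))"
proof -
  have scaleR: "(*\<^sub>R) c = (*) c" for c :: real
    by (simp add: fun_eq_iff)
  \<comment> \<open>\<open>has_derivative_partialsI\<close> takes the partial derivative as a
    bounded linear map, so the number \<open>g x y\<close> becomes multiplication by it; this
    passage is itself bounded linear and preserves continuity.\<close>
  have "isCont (\<lambda>(x, y). blinfun_scaleR_right (g x y)) (x, y)"
    using bounded_linear.isCont[OF bounded_linear_blinfun_scaleR_right assms(3)]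
    by (simp add: case_prod_unfold)
  then have "((\<lambda>(x, y). f x y) has_derivative
      (\<lambda>(tx, ty). f' tx + blinfun_apply (blinfun_scaleR_right (g x y)) ty)) (at (x, y) within UNIV \<times> UNIV)"
    using assms(1,2)
    by (intro has_derivative_partialsI) (auto simp: has_field_derivative_def scaleR)
  then show ?thesis
    by simp
qed

lemma ex_D_u_DERIV:
  assumes "ex_D_u S L" "t \<in> S"
  shows "((\<lambda>u. L t u v w) has_real_derivative D_u L t u v w) (at u)"
  using assms by (simp only: ex_D_u_def D_u_def DERIV_deriv_iff_real_differentiable)

lemma ex_D_v_DERIV:
  assumes "ex_D_v S L" "t \<in> S"
  shows "((\<lambda>v. L t u v w) has_real_derivative D_v L t u v w) (at v)"
  using assms by (simp only: ex_D_v_def D_v_def DERIV_deriv_iff_real_differentiable)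

lemma ex_D_w_DERIV:
  assumes "ex_D_w S L" "t \<in> S"
  shows "((\<lambda>w. L t u v w) has_real_derivative D_w L t u v w) (at w)"
  using assms by (simp only: ex_D_w_def D_w_def DERIV_deriv_iff_real_differentiable)

text \<open>
  The arguments are grouped as \<open>((w, v), u)\<close> because \<open>L_v\<close> is known to be continuous only in
  \<open>(v, w)\<close>, and \<open>L_w\<close> only in \<open>w\<close>: adding one variable at a time in this order needs no mixed
  derivative beyond the assumed ones.
\<close>

lemma continuous_lagrangian_at:
  assumes "continuous_lagrangian S G" "t \<in> S"
  shows "isCont (\<lambda>((w, v), u). G t u v w) p"
proof -
  have "continuous_on UNIV (\<lambda>((w, v), u). (\<lambda>(t, u, v, w). G t u v w) (t, u, v, w))"
    unfolding case_prod_unfold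
    by (rule continuous_on_compose2[OF assms(1)[unfolded continuous_lagrangian_def case_prod_unfold]])
       (use assms(2) in \<open>auto intro!: continuous_intros\<close>)
  then show ?thesis
    by (simp add: continuous_on_eq_continuous_at case_prod_unfold del: split_paired_All)
qed

lemma lagrangian_has_derivative:
  assumes "continuous_second_partials S L" "t \<in> S"
  shows "((\<lambda>((w, v), u). L t u v w) has_derivative
    (\<lambda>((r, q), p). D_w L t u v w * r + D_v L t u v w * q + D_u L t u v w * p)) (at ((w, v), u))"
proof -
  note d = assms(1)[unfolded continuous_second_partials_def]
  note cont = continuous_lagrangian_at[OF _ assms(2)]
  note du = ex_D_u_DERIV[OF _ assms(2)] and dv = ex_D_v_DERIV[OF _ assms(2)]
    and dw = ex_D_w_DERIV[OF _ assms(2)]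
  \<comment> \<open>Freezing \<open>u\<close> turns continuity in three variables into continuity in
    \<open>(w, v)\<close>.\<close>
  have slice: "isCont (\<lambda>(w, v). G t u v w) (w, v)" if "continuous_lagrangian S G" for G u v w
  proof -
    have "isCont (\<lambda>x. (x, u)) (w, v)"
      by (intro continuous_intros)
    from isCont_o2[OF this cont[OF that]] show ?thesis
      by (simp add: case_prod_unfold)
  qed
  \<comment> \<open>Adding \<open>v\<close> to \<open>L\<close> requires \<open>L_v\<close>
    continuous in \<open>(w, v)\<close>; this follows from its differentiability there, which rests
    on \<open>L_vw\<close> and the continuous \<open>L_vv\<close>.\<close>
  have "((\<lambda>(w, v). D_v L t u v w) has_derivative
      (\<lambda>(r, q). D_w (D_v L) t u v w * r + D_v (D_v L) t u v w * q)) (at (w, v))"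
    using d dw[of "D_v L", unfolded has_field_derivative_def]
    by (intro has_derivative_real_partial slice dv) auto
  then have "isCont (\<lambda>(w, v). D_v L t u v w) (w, v)"
    by (rule has_derivative_continuous)
  then have wv: "((\<lambda>(w, v). L t u v w) has_derivative
      (\<lambda>(r, q). D_w L t u v w * r + D_v L t u v w * q)) (at (w, v))"
    using d dw[of L, unfolded has_field_derivative_def]
    by (intro has_derivative_real_partial dv) auto
  \<comment> \<open>The same scheme for \<open>L_u\<close>: first in \<open>(w, v)\<close>, then in
    \<open>u\<close> through the continuous \<open>L_uu\<close>. The resulting joint continuity of
    \<open>L_u\<close> is what adding \<open>u\<close> to \<open>L\<close> requires.\<close>
  have Du_wv: "((\<lambda>(w, v). D_u L t u v w) has_derivative
      (\<lambda>(r, q). D_w (D_u L) t u v w * r + D_v (D_u L) t u v w * q)) (at (w, v))"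
    using d dw[of "D_u L", unfolded has_field_derivative_def]
    by (intro has_derivative_real_partial slice dv) auto
  have "((\<lambda>(x, u). (\<lambda>(w, v) u. D_u L t u v w) x u) has_derivative
      (\<lambda>(s, p). (\<lambda>(r, q). D_w (D_u L) t u v w * r + D_v (D_u L) t u v w * q) s
        + (\<lambda>(w, v) u. D_u (D_u L) t u v w) (w, v) u * p)) (at ((w, v), u))"
  proof (rule has_derivative_real_partial)
    show "((\<lambda>x. (\<lambda>(w, v) u. D_u L t u v w) x u) has_derivative
        (\<lambda>(r, q). D_w (D_u L) t u v w * r + D_v (D_u L) t u v w * q)) (at (w, v))"
      using Du_wv by (simp add: case_prod_unfold)
    show "((\<lambda>(w, v) u. D_u L t u v w) x has_real_derivative
        (\<lambda>(w, v) u. D_u (D_u L) t u v w) x y) (at y)" for x y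
      using d by (auto simp: case_prod_unfold intro!: du)
    show "isCont (\<lambda>(x, y). (\<lambda>(w, v) u. D_u (D_u L) t u v w) x y) ((w, v), u)"
      using cont[of "D_u (D_u L)"] d by (simp add: case_prod_unfold)
  qed
  then have Du_cont: "isCont (\<lambda>(x, u). (\<lambda>(w, v) u. D_u L t u v w) x u) ((w, v), u)"
    by (rule has_derivative_continuous)
  have "((\<lambda>(x, u). (\<lambda>(w, v) u. L t u v w) x u) has_derivative
      (\<lambda>(s, p). (\<lambda>(r, q). D_w L t u v w * r + D_v L t u v w * q) s
        + (\<lambda>(w, v) u. D_u L t u v w) (w, v) u * p)) (at ((w, v), u))"
  proof (rule has_derivative_real_partial[OF _ _ Du_cont])
    show "((\<lambda>x. (\<lambda>(w, v) u. L t u v w) x u) has_derivative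
        (\<lambda>(r, q). D_w L t u v w * r + D_v L t u v w * q)) (at (w, v))"
      using wv by (simp add: case_prod_unfold)
    show "((\<lambda>(w, v) u. L t u v w) x has_real_derivative
        (\<lambda>(w, v) u. D_u L t u v w) x y) (at y)" for x y
      using d by (auto simp: case_prod_unfold intro!: du)
  qed
  then show ?thesis
    by (simp add: case_prod_unfold)
qed

lemma lagrangian_directional_derivative:
  assumes "continuous_second_partials S L" "t \<in> S"
  shows "((\<lambda>x. L t (u + x * p) (v + x * q) (w + x * r)) has_real_derivative
    D_u L t u v w * p + D_v L t u v w * q + D_w L t u v w * r) (at 0)"
proof -
  have "((\<lambda>x. ((w + x * r, v + x * q), u + x * p)) has_derivative
      (\<lambda>x. ((x * r, x * q), x * p))) (at 0)"
    by (auto intro!: derivative_eq_intros)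
  \<comment> \<open>Simplification evaluates the line at 0, so that the base point becomes
    \<open>((w, v), u)\<close>.\<close>
  from has_derivative_compose[OF this, of "\<lambda>((w, v), u). L t u v w",
      simplified, OF lagrangian_has_derivative[OF assms]]
  have "((\<lambda>x. L t (u + x * p) (v + x * q) (w + x * r)) has_derivative
      (\<lambda>x. D_w L t u v w * (x * r) + D_v L t u v w * (x * q) + D_u L t u v w * (x * p))) (at 0)"
    by simp
  then show ?thesis
    unfolding has_field_derivative_def
    by (rule has_derivative_eq_rhs) (auto simp: algebra_simps)
qed

section \<open>Fractional sums as Toeplitz matrices\<close>

text \<open>For \<nu> > 0 this is Gamma(n + \<nu>) / (Gamma(\<nu>) n!), the coefficient of x^n in (1
  - x)^(-\<nu>). The diagonal value 1 is set apart because at \<nu> = 0, that is for differences of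
  order 1, the formula would give 0.\<close>

definition frac_weight :: "real \<Rightarrow> nat \<Rightarrow> real" where
  "frac_weight \<nu> n =
     (if n = 0 then 1 else \<nu> / Gamma (\<nu> + 1) * factorial_pow (real n + \<nu> - 1) (\<nu> - 1))"

lemma sum_steps: "(\<Sum>s\<in>steps a (a + real n). f s) = (\<Sum>i\<le>n. f (a + real i))"
  by (simp add: steps_eq_image sum.reindex inj_on_def)

text \<open>The isolated term \<open>f t\<close> is the diagonal entry of weight 1, and the sum up
  to \<open>t - 1\<close> gives the entries strictly below the diagonal.\<close>

lemma left_frac_sum_nat:
  "left_frac_sum a \<nu> f (a + real i) = (\<Sum>j\<le>i. frac_weight \<nu> (i - j) * f (a + real j))"
proof (cases i)
  case 0
  then show ?thesis
    by (simp add: left_frac_sum_def steps_empty frac_weight_def)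
next
  case (Suc n)
  have w: "frac_weight \<nu> (Suc n - j) =
      \<nu> / Gamma (\<nu> + 1) * factorial_pow (a + real (Suc n) + \<nu> - (a + real j + 1)) (\<nu> - 1)"
    if "j \<le> n" for j
    using that by (simp add: frac_weight_def Suc_diff_le of_nat_diff algebra_simps)
  have "a + real (Suc n) - 1 = a + real n"
    by simp
  then have "left_frac_sum a \<nu> f (a + real (Suc n)) = f (a + real (Suc n)) +
      (\<Sum>j\<le>n. frac_weight \<nu> (Suc n - j) * f (a + real j))"
    unfolding left_frac_sum_def by (simp only: sum_steps sum_distrib_left) (simp add: w mult.assoc)
  then show ?thesis
    by (simp add: Suc frac_weight_def)
qed

lemma right_frac_sum_nat:
  assumes "i \<le> m"
  shows "right_frac_sum (a + real m) \<nu> f (a + real i) =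
    (\<Sum>j=i..m. frac_weight \<nu> (j - i) * f (a + real j))"
proof (cases "i = m")
  case True
  then show ?thesis
    by (simp add: right_frac_sum_def steps_empty frac_weight_def)
next
  case False
  \<comment> \<open>The sum starts one step after \<open>a + real i\<close>, so it has
    \<open>n + 1\<close> terms counted from \<open>a + real i + 1\<close>; reindexing by
    \<open>Suc i\<close> returns to positions counted from \<open>a\<close>.\<close>
  define n where "n = m - Suc i"
  have m: "m = n + Suc i"
    using assms False by (simp add: n_def)
  have w: "frac_weight \<nu> (Suc j) =
      \<nu> / Gamma (\<nu> + 1) * factorial_pow (a + real i + 1 + real j + \<nu> - (a + real i + 1)) (\<nu> - 1)" for j
    by (simp add: frac_weight_def algebra_simps)
  have "a + real m = (a + real i + 1) + real n"
    by (simp add: m)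
  then have "right_frac_sum (a + real m) \<nu> f (a + real i) = f (a + real i) +
      (\<Sum>j\<le>n. frac_weight \<nu> (Suc j) * f (a + real i + 1 + real j))"
    unfolding right_frac_sum_def by (simp only: sum_steps sum_distrib_left) (simp add: w mult.assoc)
  also have "(\<Sum>j\<le>n. frac_weight \<nu> (Suc j) * f (a + real i + 1 + real j)) =
      (\<Sum>j=Suc i..m. frac_weight \<nu> (j - i) * f (a + real j))"
    by (rule sum.reindex_bij_witness[of _ "\<lambda>j. j - Suc i" "\<lambda>j. j + Suc i"])
       (auto simp: m algebra_simps Suc_diff_le)
  finally show ?thesis
    using assms by (simp add: sum.atLeast_Suc_atMost frac_weight_def)
qed

lemma left_frac_diff_nat:
  "left_frac_diff a \<alpha> f (a + real i) =
    left_frac_sum a (1 - \<alpha>) f (a + real (Suc i)) - left_frac_sum a (1 - \<alpha>) f (a + real i)"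
  by (simp add: left_frac_diff_def fwd_diff_def add_ac)

lemma right_frac_diff_nat:
  "right_frac_diff c \<alpha> f (a + real i) =
    right_frac_sum c (1 - \<alpha>) f (a + real i) - right_frac_sum c (1 - \<alpha>) f (a + real (Suc i))"
  by (simp add: right_frac_diff_def fwd_diff_def add_ac)

section \<open>Summation by parts against the indicator of a point\<close>

lemma left_frac_sum_indicator:
  "left_frac_sum a \<nu> (indicator {a + real p}) (a + real i) =
    (if p \<le> i then frac_weight \<nu> (i - p) else 0)"
  by (simp add: left_frac_sum_nat indicator_def of_bool_def if_distrib sum.delta cong: if_cong)

lemma right_frac_sum_indicator:
  assumes "i \<le> m" "p \<le> m"
  shows "right_frac_sum (a + real m) \<nu> (indicator {a + real p}) (a + real i) =
    (if i \<le> p then frac_weight \<nu> (p - i) else 0)"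
  using assms by (simp add: right_frac_sum_nat indicator_def of_bool_def if_distrib sum.delta cong: if_cong)

text \<open>The sum at \<open>Suc i\<close> meets the point \<open>Suc j\<close> with weight index
  \<open>i - j\<close>, the sum at \<open>i\<close> with index \<open>i - Suc j\<close>. Pairing
  with \<open>F\<close> thus gives right sums of \<open>F\<close> at \<open>j\<close> and at
  \<open>Suc j\<close>. They end at \<open>a + real m\<close>, where the pairing stops, which is why
  the right difference ends one step before \<open>b\<close>.\<close>

lemma sum_left_frac_diff_indicator:
  assumes "j < m"
  shows "(\<Sum>i\<le>m. F (a + real i) * left_frac_diff a \<alpha> (indicator {a + real (Suc j)}) (a + real i)) =
    right_frac_diff (a + real m) \<alpha> F (a + real j)"
proof -
  let ?w = "frac_weight (1 - \<alpha>)"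
  have "(\<Sum>i\<le>m. F (a + real i) * left_frac_diff a \<alpha> (indicator {a + real (Suc j)}) (a + real i)) =
      (\<Sum>i\<le>m. if j \<le> i then ?w (i - j) * F (a + real i) else 0) -
      (\<Sum>i\<le>m. if Suc j \<le> i then ?w (i - Suc j) * F (a + real i) else 0)"
    unfolding left_frac_diff_nat left_frac_sum_indicator sum_subtractf[symmetric]
    by (rule sum.cong) (auto simp: algebra_simps)
  also have "\<dots> = (\<Sum>i=j..m. ?w (i - j) * F (a + real i)) -
      (\<Sum>i=Suc j..m. ?w (i - Suc j) * F (a + real i))"
    by (simp add: sum.If_cases Int_def conj_commute atLeastAtMost_def atLeast_def atMost_def)
  also have "\<dots> = right_frac_diff (a + real m) \<alpha> F (a + real j)"
    using assms by (simp add: right_frac_diff_nat right_frac_sum_nat del: of_nat_Suc)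
  finally show ?thesis .
qed

text \<open>Here the sum at \<open>i\<close> meets \<open>Suc j\<close> with index
  \<open>Suc j - i\<close> and the sum at \<open>Suc i\<close> with index \<open>j - i\<close>, so
  the pairing yields left sums of \<open>F\<close> at \<open>Suc j\<close> and
  \<open>j\<close>.\<close>

lemma sum_right_frac_diff_indicator:
  assumes "j < m"
  shows "(\<Sum>i\<le>m. F (a + real i) *
      right_frac_diff (a + real (Suc m)) \<beta> (indicator {a + real (Suc j)}) (a + real i)) =
    left_frac_diff a \<beta> F (a + real j)"
proof -
  let ?w = "frac_weight (1 - \<beta>)"
  have "(\<Sum>i\<le>m. F (a + real i) *
        right_frac_diff (a + real (Suc m)) \<beta> (indicator {a + real (Suc j)}) (a + real i)) =
      (\<Sum>i\<le>m. (if i \<le> Suc j then ?w (Suc j - i) * F (a + real i) else 0)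
        - (if i \<le> j then ?w (j - i) * F (a + real i) else 0))"
    using assms
    by (intro sum.cong) (auto simp: right_frac_diff_nat right_frac_sum_indicator algebra_simps simp del: of_nat_Suc)
  also have "\<dots> = (\<Sum>i\<le>m. if i \<le> Suc j then ?w (Suc j - i) * F (a + real i) else 0)
        - (\<Sum>i\<le>m. if i \<le> j then ?w (j - i) * F (a + real i) else 0)"
    by (rule sum_subtractf)
  also have "\<dots> = (\<Sum>i\<le>Suc j. ?w (Suc j - i) * F (a + real i)) - (\<Sum>i\<le>j. ?w (j - i) * F (a + real i))"
  proof -
    \<comment> \<open>By \<open>j < m\<close> both cut-offs \<open>j\<close> and
      \<open>Suc j\<close> stay within the summation range.\<close>
    have "{..m} \<inter> {i. i \<le> l} = {..l}" if "l \<le> m" for l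
      using that by auto
    then show ?thesis
      using assms by (simp add: sum.If_cases del: sum.atMost_Suc)
  qed
  also have "\<dots> = left_frac_diff a \<beta> F (a + real j)"
    by (simp add: left_frac_diff_nat left_frac_sum_nat del: of_nat_Suc sum.atMost_Suc)
  finally show ?thesis .
qed

section \<open>Variations\<close>

lemma left_frac_diff_add: "left_frac_diff a \<alpha> (\<lambda>t. f t + g t) t =
    left_frac_diff a \<alpha> f t + left_frac_diff a \<alpha> g t"
  by (simp add: left_frac_diff_def left_frac_sum_def fwd_diff_def algebra_simps sum.distrib)

lemma right_frac_diff_add: "right_frac_diff a \<alpha> (\<lambda>t. f t + g t) t =
    right_frac_diff a \<alpha> f t + right_frac_diff a \<alpha> g t"
  by (simp add: right_frac_diff_def right_frac_sum_def fwd_diff_def algebra_simps sum.distrib)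

lemma left_frac_diff_cmult: "left_frac_diff a \<alpha> (\<lambda>t. c * f t) t = c * left_frac_diff a \<alpha> f t"
  by (simp add: left_frac_diff_def left_frac_sum_def fwd_diff_def algebra_simps sum_distrib_left)

lemma right_frac_diff_cmult: "right_frac_diff a \<alpha> (\<lambda>t. c * f t) t = c * right_frac_diff a \<alpha> f t"
  by (simp add: right_frac_diff_def right_frac_sum_def fwd_diff_def algebra_simps sum_distrib_left)

lemma Max_image_cmult:
  fixes f :: "'a \<Rightarrow> real"
  assumes "finite S" "S \<noteq> {}" "0 \<le> c"
  shows "Max ((\<lambda>t. c * f t) ` S) = c * Max (f ` S)"
proof -
  have "mono ((*) c)"
    using assms(3) by (simp add: mono_def mult_left_mono)
  from mono_Max_commute[OF this, of "f ` S"] show ?thesis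
    using assms by (simp add: image_image)
qed

text \<open>The form of \<open>b\<close> makes the index set finite and nonempty, so the scalar can
  leave each maximum. This bounds the size of a scaled variation.\<close>

lemma frac_norm_cmult:
  assumes "b = a + 1 + real n"
  shows "frac_norm a b \<alpha> \<beta> (\<lambda>t. c * f t) = \<bar>c\<bar> * frac_norm a b \<alpha> \<beta> f"
proof -
  have "b - 1 = a + real n"
    using assms by simp
  then have "finite (steps a (b - 1))" "steps a (b - 1) \<noteq> {}"
    by (simp_all add: steps_eq_image)
  then show ?thesis
    by (simp add: frac_norm_def left_frac_diff_cmult right_frac_diff_cmult abs_mult
        Max_image_cmult distrib_left)
qed

text \<open>As \<open>h\<close> vanishes at both ends, \<open>z + x * h\<close> is admissible for
  every \<open>x\<close>, and it is close to \<open>z\<close> in norm for small \<open>x\<close>.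
  The action along this line has a local minimum at 0, so its derivative vanishes there.\<close>

lemma first_variation_zero:
  assumes "b = a + 1 + real n" "continuous_second_partials (steps a (b - 1)) L"
    and "local_minimizer L a b \<alpha> \<beta> A B z" "h a = 0" "h b = 0"
  shows "(\<Sum>t\<in>steps a (b - 1).
      along (D_u L) a b \<alpha> \<beta> z t * h (t + 1)
      + along (D_v L) a b \<alpha> \<beta> z t * left_frac_diff a \<alpha> h t
      + along (D_w L) a b \<alpha> \<beta> z t * right_frac_diff b \<beta> h t) = 0" (is "?D = 0")
proof -
  let ?\<phi> = "\<lambda>x. action L a b \<alpha> \<beta> (\<lambda>t. z t + x * h t)"
  \<comment> \<open>Linearity of the fractional differences makes every summand the Lagrangian along
    a straight line.\<close>
  have deriv: "(?\<phi> has_real_derivative ?D) (at 0)"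
    unfolding action_def along_def left_frac_diff_add right_frac_diff_add
      left_frac_diff_cmult right_frac_diff_cmult
    by (intro DERIV_sum lagrangian_directional_derivative[OF assms(2)])
  obtain \<delta> where "\<delta> > 0" and min: "\<And>y. y a = z a \<Longrightarrow> y b = z b \<Longrightarrow>
      frac_norm a b \<alpha> \<beta> (\<lambda>t. y t - z t) < \<delta> \<Longrightarrow> action L a b \<alpha> \<beta> z \<le> action L a b \<alpha> \<beta> y"
    using assms(3) unfolding local_minimizer_def by metis
  let ?N = "frac_norm a b \<alpha> \<beta> h"
  \<comment> \<open>The denominator is positive and exceeds \<open>?N\<close>, so \<open>d\<close>
    works without knowing the sign of \<open>?N\<close> or whether it is zero.\<close>
  define d where "d = \<delta> / (1 + \<bar>?N\<bar>)"
  have "d > 0"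
    using \<open>\<delta> > 0\<close> by (simp add: d_def)
  moreover have "?\<phi> 0 \<le> ?\<phi> x" if "\<bar>0 - x\<bar> < d" for x
  proof -
    have "\<bar>x\<bar> * ?N \<le> \<bar>x\<bar> * (1 + \<bar>?N\<bar>)"
      by (intro mult_left_mono) auto
    also have "\<dots> < \<delta>"
      using that by (simp add: d_def pos_less_divide_eq)
    finally have "action L a b \<alpha> \<beta> z \<le> ?\<phi> x"
      using assms(4,5) by (intro min) (simp_all add: frac_norm_cmult[OF assms(1)])
    then show ?thesis
      by simp
  qed
  ultimately show ?thesis
    using DERIV_local_min[OF deriv] by blast
qed

theorem theorem3p5:
  fixes a b A B \<alpha> \<beta> :: real and k :: nat
    and L :: lagrangian and z :: "real \<Rightarrow> real"
  assumes "k \<ge> 2" and "b = a + real k"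
    and "0 < \<alpha>" and "\<alpha> \<le> 1" and "0 < \<beta>" and "\<beta> \<le> 1"
    and "continuous_second_partials (steps a (b - 1)) L"
    and "local_minimizer L a b \<alpha> \<beta> A B z"
  shows "\<forall>t\<in>steps a (b - 2).
           along (D_u L) a b \<alpha> \<beta> z t
           + right_frac_diff (b - 1) \<alpha> (along (D_v L) a b \<alpha> \<beta> z) t
           + left_frac_diff a \<beta> (along (D_w L) a b \<alpha> \<beta> z) t = 0"
proof
  fix t
  assume "t \<in> steps a (b - 2)"
  then obtain j where t: "t = a + real j" and "t \<le> b - 2"
    by (auto simp: steps_def)
  \<comment> \<open>\<open>a + real m\<close> is the last point at which the action is summed;
    \<open>t \<le> b - 2\<close> then amounts to \<open>j < m\<close>, which keeps
    \<open>t + 1\<close> strictly between \<open>a\<close> and \<open>b\<close>.\<close>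
  define m where "m = k - 1"
  have k: "k = Suc m"
    using assms(1) by (simp add: m_def)
  have b: "b = a + real (Suc m)" and b1: "b - 1 = a + real m"
    using assms(2) k by simp_all
  have "j < m"
    using \<open>t \<le> b - 2\<close> t b by simp
  let ?h = "indicator {a + real (Suc j)} :: real \<Rightarrow> real"
  let ?U = "along (D_u L) a b \<alpha> \<beta> z"
  let ?V = "along (D_v L) a b \<alpha> \<beta> z"
  let ?W = "along (D_w L) a b \<alpha> \<beta> z"
  have "?h a = 0" "?h b = 0"
    using \<open>j < m\<close> b by simp_all
  then have "(\<Sum>s\<in>steps a (b - 1). ?U s * ?h (s + 1)
      + ?V s * left_frac_diff a \<alpha> ?h s + ?W s * right_frac_diff b \<beta> ?h s) = 0"
    using b by (intro first_variation_zero[OF _ assms(7,8), where n = m]) simp_all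
  then have "(\<Sum>i\<le>m. ?U (a + real i) * ?h (a + real i + 1))
      + (\<Sum>i\<le>m. ?V (a + real i) * left_frac_diff a \<alpha> ?h (a + real i))
      + (\<Sum>i\<le>m. ?W (a + real i) * right_frac_diff b \<beta> ?h (a + real i)) = 0"
    by (simp only: b1 sum_steps sum.distrib)
  \<comment> \<open>The Lagrangian sees \<open>y\<close> at the shifted point, so the indicator of
    \<open>t + 1\<close> selects the summand at \<open>t\<close>.\<close>
  moreover have "(\<Sum>i\<le>m. ?U (a + real i) * ?h (a + real i + 1)) = ?U t"
    using \<open>j < m\<close>
    by (simp add: t indicator_def of_bool_def add.assoc if_distrib sum.delta cong: if_cong)
  moreover have "(\<Sum>i\<le>m. ?V (a + real i) * left_frac_diff a \<alpha> ?h (a + real i)) =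
      right_frac_diff (b - 1) \<alpha> ?V t"
    unfolding b1 t using \<open>j < m\<close> by (rule sum_left_frac_diff_indicator)
  moreover have "(\<Sum>i\<le>m. ?W (a + real i) * right_frac_diff b \<beta> ?h (a + real i)) =
      left_frac_diff a \<beta> ?W t"
    using sum_right_frac_diff_indicator[OF \<open>j < m\<close>, of ?W a \<beta>] by (simp only: b t)
  ultimately show "?U t + right_frac_diff (b - 1) \<alpha> ?V t + left_frac_diff a \<beta> ?W t = 0"
    by simp
qed

end
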